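(* Let $m\ge 1$ be an integer and let $\#(n)$ be the number of different blocks of length $n$ allowed in the $T_m$-shift. Then $\#(n)=F_n$ for all $n\ge 1$, where $(F_n)_{n\ge1}$ is the sequence defined by the recursive relationship $F_n=F_{n-1}+F_{n-m-1}$ for $n\ge m+2$ with the appropriate initial conditions $F_j=\#(j)$ for $1\le j\le m+1$. That is, $\#(n)=\#(n-1)+\#(n-m-1)$ for all $n\ge m+2$.
   Context: For an integer $m\ge 1$, the $T_m$-shift is the set of all bi-infinite sequences $(x_i)_{i\in\mathbb{Z}}$ with $x_i\in\{0,1\}$ in which every $1$ is isolated and any two occurrences of $1$ are separated by at least $m$ $0$'s. A block of length $n$ is a finite sequence of $n$ consecutive symbols; it is allowed if it occurs in some sequence of the shift space. *)

theory Defs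
  imports Main
begin

definition T_shift :: "nat \<Rightarrow> (int \<Rightarrow> nat) set" where
  "T_shift m = {x. (\<forall>i. x i \<in> {0, 1}) \<and>
     (\<forall>i. x i = 1 \<longrightarrow> x (i - 1) = 0 \<and> x (i + 1) = 0) \<and>
     (\<forall>i j. i < j \<and> x i = 1 \<and> x j = 1 \<longrightarrow> m \<le> card {k \<in> {i<..<j}. x k = 0})}"

definition allowed_blocks :: "(int \<Rightarrow> 'a) set \<Rightarrow> nat \<Rightarrow> 'a list set" where
  "allowed_blocks X n = {map (\<lambda>k. x (i + int k)) [0..<n] | x i. x \<in> X}"

definition block_count :: "nat \<Rightarrow> nat \<Rightarrow> nat" where
  "block_count m n = card (allowed_blocks (T_shift m) n)"

(* The sequence is indexed from 1; the value at n = 0 is irrelevant, since the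
   recursive branch (n \<ge> m + 2) only reaches indices \<ge> 1. *)
fun T_seq :: "nat \<Rightarrow> nat \<Rightarrow> nat" where
  "T_seq m n = (if n \<le> m + 1 then block_count m n
                else T_seq m (n - 1) + T_seq m (n - m - 1))"

declare T_seq.simps [simp del]

end

theory Submission
  imports Defs
begin

text \<open>
  A point of the shift is a 0-1 sequence in which distinct ones are at distance greater than
  \<open>m\<close>; any finite 0-1 word with this property extends to such a point by zeros on both sides,
  so the allowed blocks are exactly the words with this property. A word of length
  \<open>n \<ge> m + 1\<close> of this kind is either \<open>0\<close> followed by a word of length \<open>n - 1\<close>, or \<open>1 0\<^sup>m\<close> followed by
  a word of length \<open>n - m - 1\<close>, which gives the recurrence.
\<close>

text \<open>The gap is measured by positions rather than by counting zeros, so that shifting a word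
  changes nothing.\<close>

definition sparse_word :: "nat \<Rightarrow> nat list \<Rightarrow> bool" where
  "sparse_word m w \<longleftrightarrow> set w \<subseteq> {0, 1} \<and>
     (\<forall>i j. i < j \<and> j < length w \<and> w ! i = 1 \<and> w ! j = 1 \<longrightarrow> i + m < j)"

text \<open>At most \<open>j - i - 1\<close> zeros fit strictly between \<open>i\<close> and
  \<open>j\<close>, so \<open>m\<close> of them force \<open>i + m < j\<close>. Conversely, the
  \<open>m\<close> positions on either side of a one carry only zeros; as \<open>m \<ge> 1\<close>,
  these include both neighbours.\<close>

lemma T_shift_iff:
  assumes "m \<ge> 1"
  shows "x \<in> T_shift m \<longleftrightarrow>
    (\<forall>i. x i \<in> {0, 1}) \<and> (\<forall>i j. i < j \<and> x i = 1 \<and> x j = 1 \<longrightarrow> i + int m < j)"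
    (is "_ \<longleftrightarrow> ?B \<and> ?S")
proof
  assume x: "x \<in> T_shift m"
  have "i + int m < j" if "i < j" "x i = 1" "x j = 1" for i j
  proof -
    have "m \<le> card {k \<in> {i<..<j}. x k = 0}"
      using x that by (auto simp: T_shift_def)
    also have "\<dots> \<le> card {i<..<j}"
      by (intro card_mono) auto
    finally show ?thesis using \<open>i < j\<close> by simp
  qed
  then show "?B \<and> ?S" using x by (auto simp: T_shift_def)
next
  assume "?B \<and> ?S"
  then have bin: "\<And>i. x i = 0 \<or> x i = 1"
    and sep: "\<And>i j. i < j \<Longrightarrow> x i = 1 \<Longrightarrow> x j = 1 \<Longrightarrow> i + int m < j"
    by auto
  have gap: "x k = 0" if "x i = 1" "i < k" "k \<le> i + int m" for i k
    using bin[of k] sep[of i k] that by auto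
  have "x (i - 1) = 0" if "x i = 1" for i
    using bin[of "i - 1"] sep[of "i - 1" i] that assms by auto
  moreover have "x (i + 1) = 0" if "x i = 1" for i
    using gap[of i "i + 1"] that assms by auto
  moreover have "m \<le> card {k \<in> {i<..<j}. x k = 0}" if "i < j" "x i = 1" "x j = 1" for i j
  proof -
    \<comment> \<open>The \<open>m\<close> positions right after \<open>i\<close> all lie before
      \<open>j\<close> and already supply \<open>m\<close> zeros.\<close>
    have "{i<..i + int m} \<subseteq> {k \<in> {i<..<j}. x k = 0}"
      using gap[of i] sep[of i j] that by auto
    then have "card {i<..i + int m} \<le> card {k \<in> {i<..<j}. x k = 0}"
      by (intro card_mono finite_subset[OF _ finite_greaterThanLessThan_int[of i j]]) blast+
    then show ?thesis by simp
  qed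
  ultimately show "x \<in> T_shift m" using bin by (auto simp: T_shift_def)
qed

lemma allowed_blocks_T_shift:
  assumes "m \<ge> 1"
  shows "allowed_blocks (T_shift m) n = {w. length w = n \<and> sparse_word m w}"
proof (intro equalityI subsetI)
  fix w assume "w \<in> allowed_blocks (T_shift m) n"
  then obtain x i where w: "w = map (\<lambda>k. x (i + int k)) [0..<n]" and x: "x \<in> T_shift m"
    by (auto simp: allowed_blocks_def)
  have bin: "\<And>k. x k \<in> {0, 1}"
    and sep: "\<And>k l. k < l \<Longrightarrow> x k = 1 \<Longrightarrow> x l = 1 \<Longrightarrow> k + int m < l"
    using x unfolding T_shift_iff[OF assms] by blast+
  have "set w \<subseteq> {0, 1}" unfolding w set_map by (intro image_subsetI bin)
  moreover have "k + m < l" if "k < l" "l < n" "w ! k = 1" "w ! l = 1" for k l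
    using sep[of "i + int k" "i + int l"] that by (simp add: w)
  moreover have "length w = n" by (simp add: w)
  ultimately show "w \<in> {w. length w = n \<and> sparse_word m w}"
    unfolding sparse_word_def by blast
next
  fix w assume "w \<in> {w. length w = n \<and> sparse_word m w}"
  then have n: "length w = n" and bin: "set w \<subseteq> {0, 1}"
    and sep: "\<And>k l. k < l \<Longrightarrow> l < n \<Longrightarrow> w ! k = 1 \<Longrightarrow> w ! l = 1 \<Longrightarrow> k + m < l"
    by (auto simp: sparse_word_def)
  define x where "x k = (if 0 \<le> k \<and> k < int n then w ! nat k else 0)" for k :: int
  have "x k \<in> {0, 1}" for k
    using subsetD[OF bin nth_mem[of "nat k" w]] n by (auto simp: x_def)
  moreover have "k + int m < l" if "k < l" "x k = 1" "x l = 1" for k l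
  proof -
    \<comment> \<open>The default value of \<open>x\<close> is 0, so its ones lie inside the window,
      where \<open>nat\<close> loses nothing.\<close>
    have "0 \<le> k" "l < int n" "w ! nat k = 1" "w ! nat l = 1"
      using that by (auto simp: x_def split: if_splits)
    moreover from this have "nat k + m < nat l"
      using \<open>k < l\<close> by (intro sep) auto
    ultimately show ?thesis by linarith
  qed
  ultimately have "x \<in> T_shift m" by (simp add: T_shift_iff[OF assms])
  moreover have "w = map (\<lambda>k. x (0 + int k)) [0..<n]"
    by (intro nth_equalityI) (auto simp: x_def n)
  ultimately show "w \<in> allowed_blocks (T_shift m) n"
    unfolding allowed_blocks_def by blast
qed

text \<open>Old pairs of ones move together by one place. The only new pairs join position 0 to some
  \<open>Suc j\<close>, and \<open>m < Suc j\<close> excludes exactly the \<open>j < m\<close>. The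
  bound by \<open>length w\<close> covers words shorter than \<open>m\<close>.\<close>

lemma sparse_word_Cons:
  "sparse_word m (a # w) \<longleftrightarrow>
     a \<in> {0, 1} \<and> sparse_word m w \<and> (a = 1 \<longrightarrow> (\<forall>j < length w. j < m \<longrightarrow> w ! j = 0))"
  (is "?L \<longleftrightarrow> ?R")
proof
  assume L: ?L
  then have sep: "\<And>i j. i < j \<Longrightarrow> j < Suc (length w) \<Longrightarrow> (a # w) ! i = 1 \<Longrightarrow> (a # w) ! j = 1
      \<Longrightarrow> i + m < j"
    and bin: "set (a # w) \<subseteq> {0, 1}"
    by (auto simp: sparse_word_def)
  have "i + m < j" if "i < j" "j < length w" "w ! i = 1" "w ! j = 1" for i j
    using sep[of "Suc i" "Suc j"] that by simp
  moreover have "w ! j = 0" if "a = 1" "j < length w" "j < m" for j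
  proof -
    have "w ! j \<in> {0, 1}" using bin nth_mem[OF that(2)] by auto
    moreover have "w ! j \<noteq> 1" using sep[of 0 "Suc j"] that by auto
    ultimately show ?thesis by simp
  qed
  ultimately show ?R using bin by (auto simp: sparse_word_def)
next
  assume R: ?R
  then have "i + m < j"
    if "i < j" "j < length (a # w)" "(a # w) ! i = 1" "(a # w) ! j = 1" for i j
    using that by (cases i; cases j) (force simp: sparse_word_def not_less)+
  then show ?L using R by (auto simp: sparse_word_def)
qed

lemma sparse_word_replicate_zero_append:
  "sparse_word m (replicate k 0 @ w) \<longleftrightarrow> sparse_word m w"
  by (induction k) (auto simp: sparse_word_Cons)

lemma sparse_words_split:
  "{w. length w = Suc (m + n) \<and> sparse_word m w} =
     (\<lambda>w. 0 # w) ` {w. length w = m + n \<and> sparse_word m w} \<union>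
     (\<lambda>w. 1 # replicate m 0 @ w) ` {w. length w = n \<and> sparse_word m w}"
  (is "?L = ?A \<union> ?B")
proof (intro equalityI subsetI)
  fix v assume "v \<in> ?L"
  then obtain a w where v: "v = a # w" "length w = m + n" and s: "sparse_word m (a # w)"
    by (cases v) auto
  show "v \<in> ?A \<union> ?B"
  proof (cases "a = 0")
    case True
    then show ?thesis using v s by (auto simp: sparse_word_Cons)
  next
    case False
    then have a: "a = 1" and "sparse_word m w" and z: "\<And>j. j < m \<Longrightarrow> w ! j = 0"
      using s v by (auto simp: sparse_word_Cons)
    \<comment> \<open>Since \<open>length w = m + n\<close>, the whole run of \<open>m\<close> zeros
      forced by the leading one fits into \<open>w\<close>.\<close>
    have "take m w = replicate m 0"
      by (intro nth_equalityI) (auto simp: v z)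
    then have w: "w = replicate m 0 @ drop m w"
      by (metis append_take_drop_id)
    then have "sparse_word m (drop m w)"
      using \<open>sparse_word m w\<close> by (metis sparse_word_replicate_zero_append)
    then have "v \<in> ?B"
      using v a w by (intro image_eqI[of _ _ "drop m w"]) auto
    then show ?thesis ..
  qed
next
  fix v assume "v \<in> ?A \<union> ?B"
  then show "v \<in> ?L"
    by (auto simp: sparse_word_Cons sparse_word_replicate_zero_append nth_append)
qed

lemma finite_sparse_words: "finite {w. length w = n \<and> sparse_word m w}"
  by (rule finite_subset[OF _ finite_lists_length_eq[of "{0, 1}" n]])
    (auto simp: sparse_word_def)

lemma block_count_rec:
  assumes "m \<ge> 1"
  shows "block_count m (Suc (m + n)) = block_count m (m + n) + block_count m n"
  unfolding block_count_def allowed_blocks_T_shift[OF assms] sparse_words_split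
  \<comment> \<open>The two images differ in the first letter, and prefixing a fixed word is
    injective.\<close>
  by (subst card_Un_disjoint) (auto simp: finite_sparse_words card_image inj_on_def)

theorem lemma3:
  fixes m :: nat
  assumes "m \<ge> 1"
  shows "(\<forall>n\<ge>1. block_count m n = T_seq m n) \<and>
         (\<forall>n\<ge>m + 2. block_count m n = block_count m (n - 1) + block_count m (n - m - 1))"
proof -
  have rec: "block_count m n = block_count m (n - 1) + block_count m (n - m - 1)"
    if "n \<ge> m + 2" for n
    using block_count_rec[OF assms, of "n - m - 1"] that by simp
  have "block_count m n = T_seq m n" if "n \<ge> 1" for n
    using that
  proof (induction n rule: less_induct)
    case (less n)
    show ?case
    proof (cases "n \<le> m + 1")
      case True
      then show ?thesis by (simp add: T_seq.simps[of m n])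
    next
      case False
      \<comment> \<open>Here \<open>n \<ge> m + 2\<close>, so \<open>n - 1\<close> and
        \<open>n - m - 1\<close> are both at least 1 and below \<open>n\<close>, as the induction
        hypothesis requires.\<close>
      then show ?thesis
        using rec[of n] less.IH[of "n - 1"] less.IH[of "n - m - 1"]
        by (simp add: T_seq.simps[of m n])
    qed
  qed
  with rec show ?thesis by blast
qed

end
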